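(* Let $G$ be a labeled acyclic digraph. The following three statements are equivalent: (i) For every interval $[x,y]$ of $G$ and every non-negative integer $k$, the number of rising paths from $x$ to $y$ of length $k$ equals the number of falling paths from $x$ to $y$ of length $k$. (ii) For every interval $[x,y]$ of $G$ and every even positive integer $k$, the number of rising paths from $x$ to $y$ of length $k$ equals the number of falling paths from $x$ to $y$ of length $k$. (iii) For every interval $[x,y]$ of $G$ with $x<y$, the ${\bf a}{\bf b}$-index $\Psi([x,y])$ lies in $\mathbb{Z}\langle{\bf c},{\bf d}\rangle$, i.e. it can be written as a polynomial with integer coefficients in the non-commuting elements ${\bf c}={\bf a}+{\bf b}$ and ${\bf d}={\bf a}{\bf b}+{\bf b}{\bf a}$.
   Context: A labeled acyclic digraph $G=(V,E)$ is a directed graph (multiple edges allowed) with no directed cycles which is locally finite (there are finitely many directed paths between any two vertices), together with a set $\Lambda$ carrying an arbitrary binary relation $\sim$ (an arbitrary subset of $\Lambda\times\Lambda$) and a labeling map $\lambda:E\to\Lambda$. Each edge $e$ has a tail and a head. A directed path of length $k$ from $x$ to $y$ is a sequence of edges $(e_1,\dots,e_k)$ with $\operatorname{tail}(e_1)=x$, $\operatorname{head}(e_k)=y$ and $\operatorname{head}(e_i)=\operatorname{tail}(e_{i+1})$. Write $x\le y$ if there is a directed path from $x$ to $y$; this is a partial order. The interval $[x,y]$ is the set of vertices $z$ with $x\le z\le y$, viewed as the induced labeled subgraph. A path $(e_1,\dots,e_k)$ is rising if $\lambda(e_i)\sim\lambda(e_{i+1})$ for all $1\le i\le k-1$, and falling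 if $\lambda(e_i)\not\sim\lambda(e_{i+1})$ for all $1\le i\le k-1$. Let ${\bf a},{\bf b}$ be non-commuting variables of degree $1$ and $\mathbb{Z}\langle{\bf a},{\bf b}\rangle$ the non-commutative polynomial ring. For a path $p=(e_1,\dots,e_k)$, $k\ge1$, its descent word is $u(p)=u_1\cdots u_{k-1}$ with $u_i={\bf a}$ if $\lambda(e_i)\sim\lambda(e_{i+1})$ and $u_i={\bf b}$ otherwise. For $x<y$ the ${\bf a}{\bf b}$-index is $\Psi([x,y])=\sum_p u(p)$, summed over all directed paths $p$ from $x$ to $y$. *)

theory Defs
  imports "Graph_Theory.Arc_Walk" "HOL-Library.Poly_Mapping"
begin

section \<open>Non-commutative polynomials\<close>

text \<open>
  Words form the free monoid, written additively because the ring structure on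
  \<open>'a \<Rightarrow>\<^sub>0 'b\<close> takes an additive (not necessarily commutative) monoid of exponents.
  The product of \<open>'x ncpoly\<close> is therefore the concatenation product, and
  \<open>'x ncpoly\<close> is the free associative unital ring on \<open>'x\<close>.
\<close>

datatype 'x free_word = Word (letters: "'x list")

instantiation free_word :: (type) monoid_add
begin

definition zero_free_word :: "'a free_word" where
  "0 = Word []"

definition plus_free_word :: "'a free_word \<Rightarrow> 'a free_word \<Rightarrow> 'a free_word" where
  "v + w = Word (letters v @ letters w)"

instance
  by standard (simp_all add: zero_free_word_def plus_free_word_def)

end

type_synonym 'x ncpoly = "'x free_word \<Rightarrow>\<^sub>0 int"

definition ncvar :: "'x \<Rightarrow> 'x ncpoly" where
  "ncvar x = Poly_Mapping.single (Word [x]) 1"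

text \<open>Substitution of (non-commuting) ring elements for the variables.\<close>

definition nc_subst :: "('x \<Rightarrow> 'r::ring_1) \<Rightarrow> 'x ncpoly \<Rightarrow> 'r" where
  "nc_subst f P =
    (\<Sum>w\<in>Poly_Mapping.keys P.
       of_int (Poly_Mapping.lookup P w) * prod_list (map f (letters w)))"

datatype ab = A | B
datatype cd = C | D

fun cd_element :: "cd \<Rightarrow> ab ncpoly" where
  "cd_element C = ncvar A + ncvar B"
| "cd_element D = ncvar A * ncvar B + ncvar B * ncvar A"

definition cd_polynomials :: "ab ncpoly set" where
  "cd_polynomials = range (nc_subst cd_element)"


section \<open>Labeled acyclic digraphs\<close>

text \<open>
  The label relation is an arbitrary subset of \<open>\<Lambda> \<times> \<Lambda>\<close>. A directed path is a list of
  consecutive arcs (\<open>awalk\<close>); the empty list is a path of length 0 from each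
  vertex to itself.
\<close>

locale labeled_acyclic_digraph = wf_digraph G
  for G :: "('v, 'e) pre_digraph" (structure) +
  fixes \<Lambda> :: "'l set" and rel :: "('l \<times> 'l) set" and lab :: "'e \<Rightarrow> 'l"
  assumes no_cycle: "\<not> cycle p"
    and locally_finite: "\<lbrakk>x \<in> verts G; y \<in> verts G\<rbrakk> \<Longrightarrow> finite {p. awalk x p y}"
    and rel_labels: "rel \<subseteq> \<Lambda> \<times> \<Lambda>"
    and lab_labels: "e \<in> arcs G \<Longrightarrow> lab e \<in> \<Lambda>"

definition dipaths :: "('v, 'e) pre_digraph \<Rightarrow> 'v \<Rightarrow> 'v \<Rightarrow> 'e list set" where
  "dipaths G x y = {p. pre_digraph.awalk G x p y}"

definition path_le :: "('v, 'e) pre_digraph \<Rightarrow> 'v \<Rightarrow> 'v \<Rightarrow> bool" where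
  "path_le G x y \<longleftrightarrow> dipaths G x y \<noteq> {}"

definition path_less :: "('v, 'e) pre_digraph \<Rightarrow> 'v \<Rightarrow> 'v \<Rightarrow> bool" where
  "path_less G x y \<longleftrightarrow> path_le G x y \<and> x \<noteq> y"

definition rising :: "('l \<times> 'l) set \<Rightarrow> ('e \<Rightarrow> 'l) \<Rightarrow> 'e list \<Rightarrow> bool" where
  "rising rel lab p \<longleftrightarrow> (\<forall>i. Suc i < length p \<longrightarrow> (lab (p ! i), lab (p ! Suc i)) \<in> rel)"

definition falling :: "('l \<times> 'l) set \<Rightarrow> ('e \<Rightarrow> 'l) \<Rightarrow> 'e list \<Rightarrow> bool" where
  "falling rel lab p \<longleftrightarrow> (\<forall>i. Suc i < length p \<longrightarrow> (lab (p ! i), lab (p ! Suc i)) \<notin> rel)"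

definition num_rising ::
  "('v, 'e) pre_digraph \<Rightarrow> ('l \<times> 'l) set \<Rightarrow> ('e \<Rightarrow> 'l) \<Rightarrow> 'v \<Rightarrow> 'v \<Rightarrow> nat \<Rightarrow> nat" where
  "num_rising G rel lab x y k =
    card {p \<in> dipaths G x y. rising rel lab p \<and> length p = k}"

definition num_falling ::
  "('v, 'e) pre_digraph \<Rightarrow> ('l \<times> 'l) set \<Rightarrow> ('e \<Rightarrow> 'l) \<Rightarrow> 'v \<Rightarrow> 'v \<Rightarrow> nat \<Rightarrow> nat" where
  "num_falling G rel lab x y k =
    card {p \<in> dipaths G x y. falling rel lab p \<and> length p = k}"

definition descent_word :: "('l \<times> 'l) set \<Rightarrow> ('e \<Rightarrow> 'l) \<Rightarrow> 'e list \<Rightarrow> ab ncpoly" where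
  "descent_word rel lab p =
    prod_list (map (\<lambda>i. if (lab (p ! i), lab (p ! Suc i)) \<in> rel then ncvar A else ncvar B)
      [0..<length p - 1])"

text \<open>
  The index of the interval \<open>[x, y]\<close>, for \<open>x < y\<close>. Every directed path of \<open>G\<close> from \<open>x\<close>
  to \<open>y\<close> stays inside \<open>[x, y]\<close>, so the sum ranges over the paths of \<open>G\<close> itself.
\<close>

definition ab_index ::
  "('v, 'e) pre_digraph \<Rightarrow> ('l \<times> 'l) set \<Rightarrow> ('e \<Rightarrow> 'l) \<Rightarrow> 'v \<Rightarrow> 'v \<Rightarrow> ab ncpoly" where
  "ab_index G rel lab x y = (\<Sum>p\<in>dipaths G x y. descent_word rel lab p)"

end

theory Submission
  imports Defs
begin

text \<open>
  Let \<open>R\<^sub>k\<close>, \<open>F\<^sub>k\<close> count the rising and falling paths of length \<open>k\<close>, as matrices indexed by the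
  vertices. The relations \<open>\<Sum>\<^sub>i (-1)\<^sup>i R\<^sub>i F\<^sub>k\<^sub>-\<^sub>i = 0\<close> show that \<open>R\<^sub>k = F\<^sub>k\<close> for even \<open>k\<close>
  implies the same for odd \<open>k\<close>. With \<open>c = a + b\<close> and \<open>e = a - b\<close>, the path sum \<open>S\<^sub>k\<close> of the functional
  \<open>e\<^sup>k\<^sup>-\<^sup>1\<close> is the same expression in the \<open>R\<^sub>i\<close> as \<open>(-1)\<^sup>k\<^sup>-\<^sup>1 S\<^sub>k\<close> is in the \<open>F\<^sub>i\<close>; so if \<open>R = F\<close>,
  then \<open>S\<^sub>k = 0\<close> for even \<open>k\<close>. Cutting paths at a letter \<open>c\<close>, which puts no condition on the
  junction, the index pairs to 0 with every \<open>ce\<close>-word having a maximal run of \<open>e\<close> of odd length,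
  and this characterizes polynomials in \<open>c\<close> and \<open>d\<close>. Conversely these are invariant under
  exchanging \<open>a\<close> and \<open>b\<close>, which exchanges rising and falling paths.
\<close>

section \<open>Polynomials in c and d\<close>

lemma single_0_int: "Poly_Mapping.single (0 :: 'x free_word) (k :: int) = of_int k"
  by (metis of_int_eq_id id_apply single_of_int)

lemma nc_subst_superset:
  assumes "finite K" "Poly_Mapping.keys P \<subseteq> K"
  shows "nc_subst f P = (\<Sum>w\<in>K. of_int (Poly_Mapping.lookup P w) * prod_list (map f (letters w)))"
  unfolding nc_subst_def using assms
  by (intro sum.mono_neutral_left) (auto simp: in_keys_iff)

lemma nc_subst_zero: "nc_subst f 0 = 0"
  by (simp add: nc_subst_def)

lemma nc_subst_single:
  "nc_subst f (Poly_Mapping.single w k) = of_int k * prod_list (map f (letters w))"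
  by (subst nc_subst_superset[of "{w}"]) (auto simp: lookup_single)

lemma nc_subst_add: "nc_subst f (P + Q) = nc_subst f P + nc_subst f Q"
proof -
  let ?K = "Poly_Mapping.keys P \<union> Poly_Mapping.keys Q"
  have "Poly_Mapping.keys (P + Q) \<subseteq> ?K"
    by (rule keys_add)
  then show ?thesis
    by (simp add: nc_subst_superset[of ?K] lookup_add distrib_right sum.distrib)
qed

lemma nc_subst_sum: "nc_subst f (\<Sum>i\<in>I. P i) = (\<Sum>i\<in>I. nc_subst f (P i))"
  by (induction I rule: infinite_finite_induct) (simp_all add: nc_subst_zero nc_subst_add)

lemma cd_polynomials_zero: "0 \<in> cd_polynomials"
  unfolding cd_polynomials_def by (metis nc_subst_zero rangeI)

lemma cd_polynomials_add:
  assumes "P \<in> cd_polynomials" "Q \<in> cd_polynomials"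
  shows "P + Q \<in> cd_polynomials"
  using assms unfolding cd_polynomials_def by (auto simp flip: nc_subst_add)

lemma cd_polynomials_sum:
  assumes "\<And>i. i \<in> I \<Longrightarrow> P i \<in> cd_polynomials"
  shows "(\<Sum>i\<in>I. P i) \<in> cd_polynomials"
  using assms
  by (induction I rule: infinite_finite_induct)
    (simp_all add: cd_polynomials_zero cd_polynomials_add)

lemma cd_polynomials_const: "Poly_Mapping.single (Word []) k \<in> cd_polynomials"
proof -
  have "nc_subst cd_element (Poly_Mapping.single (Word []) k) = of_int k"
    by (simp add: nc_subst_single)
  also have "\<dots> = Poly_Mapping.single (Word []) k"
    by (simp add: single_0_int flip: zero_free_word_def)
  finally show ?thesis
    unfolding cd_polynomials_def by (metis rangeI)
qed

text \<open>Prefixing \<open>x\<close> to every word of a preimage \<open>Q\<close> multiplies its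
  image by \<open>cd_element x\<close>, since integers are central.\<close>

lemma cd_polynomials_mult_left:
  assumes "P \<in> cd_polynomials"
  shows "cd_element x * P \<in> cd_polynomials"
proof -
  obtain Q where Q: "P = nc_subst cd_element Q"
    using assms by (auto simp: cd_polynomials_def)
  define Q' where "Q' = (\<Sum>w\<in>Poly_Mapping.keys Q.
    Poly_Mapping.single (Word (x # letters w)) (Poly_Mapping.lookup Q w))"
  have "nc_subst cd_element Q' = cd_element x * P"
    unfolding Q'_def Q nc_subst_sum nc_subst_single
    unfolding nc_subst_def sum_distrib_left
    by (intro sum.cong refl) (simp, metis mult.assoc mult_of_int_commute)
  then show ?thesis
    unfolding cd_polynomials_def by (metis rangeI)
qed

section \<open>Coefficients, and symmetry under exchanging a and b\<close>

lemma lookup_ncvar_mult_Nil: "Poly_Mapping.lookup (ncvar x * P) (Word []) = 0"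
  using subset_UNIV
proof (induction P rule: frag_induction)
  case (one w)
  then show ?case
    by (simp add: ncvar_def mult_single plus_free_word_def lookup_single)
qed (simp_all add: right_diff_distrib lookup_minus)

lemma lookup_ncvar_mult_Cons:
  "Poly_Mapping.lookup (ncvar x * P) (Word (y # w)) =
    (if y = x then Poly_Mapping.lookup P (Word w) else 0)"
  using subset_UNIV
proof (induction P rule: frag_induction)
  case (one v)
  then show ?case
    by (cases v)
      (auto simp: ncvar_def mult_single plus_free_word_def lookup_single when_def)
qed (simp_all add: right_diff_distrib lookup_minus)

fun flip_ab :: "ab \<Rightarrow> ab" where
  "flip_ab A = B"
| "flip_ab B = A"

text \<open>Splitting off one letter for c, or two for d, leaves a coefficient of \<open>P\<close>;
  both a + b and ab + ba are symmetric.\<close>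

lemma lookup_cd_element_mult_flip:
  assumes "\<And>w. Poly_Mapping.lookup P (Word (map flip_ab w)) = Poly_Mapping.lookup P (Word w)"
  shows "Poly_Mapping.lookup (cd_element x * P) (Word (map flip_ab w)) =
    Poly_Mapping.lookup (cd_element x * P) (Word w)"
proof (cases w)
  case Nil
  then show ?thesis by simp
next
  case (Cons y v)
  show ?thesis
  proof (cases x)
    case C
    then show ?thesis
      using Cons assms
      by (cases y) (simp_all add: distrib_right lookup_add lookup_ncvar_mult_Cons)
  next
    case D
    have v: "v = [] \<or> (\<exists>u. v = A # u) \<or> (\<exists>u. v = B # u)"
      by (metis ab.exhaust list.exhaust)
    show ?thesis
      using Cons D v assms
      by (cases y) (auto simp: distrib_right lookup_add lookup_ncvar_mult_Cons
        lookup_ncvar_mult_Nil mult.assoc)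
  qed
qed

lemma lookup_cd_monomial_flip:
  "Poly_Mapping.lookup (prod_list (map cd_element m)) (Word (map flip_ab w)) =
    Poly_Mapping.lookup (prod_list (map cd_element m)) (Word w)"
proof (induction m arbitrary: w)
  case Nil
  then show ?case
    by (cases w) (simp_all add: lookup_one zero_free_word_def when_def)
next
  case (Cons x m)
  then show ?case
    by (simp add: lookup_cd_element_mult_flip)
qed

lemma lookup_of_int_mult:
  "Poly_Mapping.lookup (of_int k * P) w = k * Poly_Mapping.lookup (P :: 'x ncpoly) w"
proof -
  have "of_int k * P = Poly_Mapping.map ((*) k) P"
    by (simp add: mult_map_scale_conv_mult single_0_int)
  then show ?thesis
    by (simp add: map.rep_eq when_def)
qed

lemma cd_polynomials_lookup_flip:
  assumes "P \<in> cd_polynomials"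
  shows "Poly_Mapping.lookup P (Word (map flip_ab w)) = Poly_Mapping.lookup P (Word w)"
  using assms
  by (auto simp: cd_polynomials_def nc_subst_def lookup_sum lookup_of_int_mult
    lookup_cd_monomial_flip)


section \<open>An integral criterion for being a polynomial in c and d\<close>

text \<open>The homogeneous polynomial of degree \<open>n\<close> with coefficient
  \<open>f w\<close> at each word \<open>w\<close> of length \<open>n\<close>, built so that first
  letters factor out on the left.\<close>

fun hom_poly :: "nat \<Rightarrow> (ab list \<Rightarrow> int) \<Rightarrow> ab ncpoly" where
  "hom_poly 0 f = Poly_Mapping.single (Word []) (f [])"
| "hom_poly (Suc n) f =
    ncvar A * hom_poly n (\<lambda>w. f (A # w)) + ncvar B * hom_poly n (\<lambda>w. f (B # w))"

lemma hom_poly_add: "hom_poly n (\<lambda>w. f w + g w) = hom_poly n f + hom_poly n g"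
  by (induction n arbitrary: f g) (simp_all add: single_add distrib_left)

lemma hom_poly_diff: "hom_poly n (\<lambda>w. f w - g w) = hom_poly n f - hom_poly n g"
  by (induction n arbitrary: f g) (simp_all add: single_diff right_diff_distrib)

lemma hom_poly_zero: "hom_poly n (\<lambda>w. 0) = 0"
  by (induction n) simp_all

lemma hom_poly_sum: "hom_poly n (\<lambda>w. \<Sum>i\<in>I. f i w) = (\<Sum>i\<in>I. hom_poly n (f i))"
  by (induction I rule: infinite_finite_induct) (simp_all add: hom_poly_zero hom_poly_add)

lemma hom_poly_cong:
  assumes "\<And>w. length w = n \<Longrightarrow> f w = g w"
  shows "hom_poly n f = hom_poly n g"
  using assms
proof (induction n arbitrary: f g)
  case (Suc n)
  have "hom_poly n (\<lambda>w. f (x # w)) = hom_poly n (\<lambda>w. g (x # w))" for x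
    by (rule Suc.IH) (simp add: Suc.prems)
  then show ?case by simp
qed simp

lemma hom_poly_indicator:
  "hom_poly (length v) (\<lambda>w. of_bool (v = w)) = Poly_Mapping.single (Word v) 1"
proof (induction v)
  case (Cons x v)
  then show ?case
    by (cases x) (simp_all add: hom_poly_zero ncvar_def mult_single plus_free_word_def)
qed simp

text \<open>
  A list over \<^typ>\<open>bool\<close> encodes a word in \<open>c = a + b\<close> (\<open>False\<close>) and \<open>e = a - b\<close> (\<open>True\<close>).
  Over the rationals \<open>d = (c\<^sup>2 - e\<^sup>2) / 2\<close>, so the polynomials in \<open>c\<close> and \<open>d\<close> are those
  whose \<open>ce\<close>-words are products of \<open>c\<close> and \<open>ee\<close>. Up to a power of 2, \<open>ce_pair f z\<close> is the
  coefficient of the word \<open>z\<close>.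
\<close>

fun ce_sign :: "bool list \<Rightarrow> ab list \<Rightarrow> int" where
  "ce_sign (z # zs) (w # ws) = (if z \<and> w = B then - 1 else 1) * ce_sign zs ws"
| "ce_sign _ _ = 1"

fun ce_pair :: "(ab list \<Rightarrow> int) \<Rightarrow> bool list \<Rightarrow> int" where
  "ce_pair f [] = f []"
| "ce_pair f (z # zs) =
    ce_pair (\<lambda>w. f (A # w)) zs + (if z then - 1 else 1) * ce_pair (\<lambda>w. f (B # w)) zs"

fun even_runs :: "bool list \<Rightarrow> bool" where
  "even_runs [] = True"
| "even_runs (False # z) = even_runs z"
| "even_runs (True # True # z) = even_runs z"
| "even_runs _ = False"

lemma ce_pair_add: "ce_pair (\<lambda>w. f w + g w) z = ce_pair f z + ce_pair g z"
  by (induction z arbitrary: f g) (simp_all add: algebra_simps)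

lemma ce_pair_diff: "ce_pair (\<lambda>w. f w - g w) z = ce_pair f z - ce_pair g z"
  by (induction z arbitrary: f g) (simp_all add: algebra_simps)

lemma ce_pair_zero: "ce_pair (\<lambda>w. 0) z = 0"
  by (induction z) simp_all

lemma ce_pair_sum: "ce_pair (\<lambda>w. \<Sum>i\<in>I. f i w) z = (\<Sum>i\<in>I. ce_pair (f i) z)"
  by (induction I rule: infinite_finite_induct) (simp_all add: ce_pair_zero ce_pair_add)

text \<open>By linearity this turns the pairing of a path count into a signed sum over
  paths.\<close>

lemma ce_pair_indicator:
  assumes "length v = length z"
  shows "ce_pair (\<lambda>w. of_bool (v = w)) z = ce_sign z v"
  using assms
proof (induction v z rule: list_induct2)
  case (Cons x v y z)
  then show ?case
    by (cases x) (simp_all add: ce_pair_zero)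
qed simp

text \<open>Pairing with \<open>False # z\<close> and \<open>True # z\<close> gives the sum and the
  difference of the two halves of \<open>f\<close>; both vanish, hence so does twice each
  half.\<close>

lemma ce_pair_nondegenerate:
  assumes "\<And>z. length z = n \<Longrightarrow> ce_pair f z = 0" and "length w = n"
  shows "f w = 0"
  using assms
proof (induction n arbitrary: f w)
  case (Suc n)
  obtain x v where w: "w = x # v" "length v = n"
    using Suc.prems(2) by (cases w) auto
  have "ce_pair (\<lambda>w. f (x # w)) z = 0" if "length z = n" for z
    using Suc.prems(1)[of "True # z"] Suc.prems(1)[of "False # z"] that
    by (cases x) simp_all
  from Suc.IH[OF this w(2)] show ?case
    by (simp add: w)
qed simp

text \<open>
  Writing \<open>f = a g + b h\<close>, an equation \<open>f = c p + d q\<close> means \<open>h - g = (a - b) q\<close> and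
  \<open>p = g - b q\<close>; so \<open>p\<close> and \<open>q\<close> have integer coefficients once they exist.
\<close>

lemma hom_poly_cd:
  assumes "\<And>z. length z = n \<Longrightarrow> \<not> even_runs z \<Longrightarrow> ce_pair f z = 0"
  shows "hom_poly n f \<in> cd_polynomials"
  using assms
proof (induction n arbitrary: f rule: less_induct)
  case (less n)
  consider "n = 0" | "n = 1" | m where "n = Suc (Suc m)"
    by (metis One_nat_def not0_implies_Suc)
  then show ?case
  proof cases
    case 1
    then show ?thesis by (simp add: cd_polynomials_const)
  next
    case 2
    have "f [A] = f [B]"
      using less.prems[of "[True]"] 2 by simp
    then have "hom_poly n f = cd_element C * Poly_Mapping.single (Word []) (f [A])"
      using 2 by (simp add: distrib_right)
    then show ?thesis
      using cd_polynomials_mult_left cd_polynomials_const by metis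
  next
    case n: 3
    \<comment> \<open>With g and h the parts of \<open>f\<close> after \<open>A\<close> and after
      \<open>B\<close>, \<open>q\<close> is the a-part of h - g = (a - b) q, and \<open>p\<close> is
      g - b q. The value of \<open>p\<close> at the empty word is a dummy, as \<open>p\<close> is
      used in degree \<open>Suc m\<close>.\<close>
    define q where "q = (\<lambda>w. f (B # A # w) - f (A # A # w))"
    define p where "p = (\<lambda>w. case w of [] \<Rightarrow> 0
      | x # v \<Rightarrow> (if x = A then f (A # A # v) else f (A # B # v) - q v))"
    let ?P = "\<lambda>x y z. ce_pair (\<lambda>w. f (x # y # w)) z"
    \<comment> \<open>The word e c z begins with a run of e of length 1.\<close>
    have ec: "?P A A z + ?P A B z - ?P B A z - ?P B B z = 0" if "length z = m" for z
      using less.prems[of "True # False # z"] n that by simp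
    \<comment> \<open>This is the b-part of h - g = (a - b) q, obtained from \<open>ec\<close> by
      nondegeneracy.\<close>
    have "f (A # A # w) + f (A # B # w) - f (B # A # w) - f (B # B # w) = 0"
      if "length w = m" for w
      by (rule ce_pair_nondegenerate[where n = m and w = w and
            f = "\<lambda>w. f (A # A # w) + f (A # B # w) - f (B # A # w) - f (B # B # w)", OF _ that])
        (simp_all only: ce_pair_add ce_pair_diff ec)
    then have BB: "hom_poly m (\<lambda>w. f (B # B # w)) =
        hom_poly m (\<lambda>w. f (A # B # w)) - hom_poly m q"
      unfolding hom_poly_diff[symmetric]
      by (intro hom_poly_cong) (fastforce simp: q_def)
    have BA: "hom_poly m (\<lambda>w. f (B # A # w)) = hom_poly m (\<lambda>w. f (A # A # w)) + hom_poly m q"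
      by (simp add: q_def hom_poly_diff)
    have split: "hom_poly n f =
        cd_element C * hom_poly (Suc m) p + cd_element D * hom_poly m q"
      by (simp add: n p_def hom_poly_diff BA BB algebra_simps)
    have "hom_poly m q \<in> cd_polynomials"
    proof (rule less.IH)
      fix z assume z: "length z = m" "\<not> even_runs z"
      \<comment> \<open>Putting ee or cc before \<open>z\<close> keeps its odd run. Together with
        \<open>ec\<close> this forces \<open>?P A A z\<close> and \<open>?P B A z\<close> to
        agree.\<close>
      show "ce_pair q z = 0"
        using ec[OF z(1)] less.prems[of "True # True # z"] less.prems[of "False # False # z"] z n
        by (simp add: q_def ce_pair_diff)
    qed (simp add: n)
    moreover have "hom_poly (Suc m) p \<in> cd_polynomials"
    proof (rule less.IH)
      fix z' assume z': "length z' = Suc m" "\<not> even_runs z'"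
      then obtain s z where z: "z' = s # z" "length z = m"
        by (cases z') auto
      show "ce_pair p z' = 0"
      proof (cases s)
        case True
        \<comment> \<open>The words c e z and e c z give equal pairings \<open>?P A B z\<close> and
          \<open>?P B A z\<close>, whose difference is \<open>ce_pair p z'\<close> up to
          sign.\<close>
        then show ?thesis
          using ec[OF z(2)] less.prems[of "False # True # z"] z' z n
          by (simp add: p_def q_def ce_pair_diff)
      next
        case False
        then show ?thesis
          using ec[OF z(2)] less.prems[of "True # True # z"] less.prems[of "False # False # z"]
            z' z n
          by (simp add: p_def q_def ce_pair_diff)
      qed
    qed (simp add: n)
    ultimately show ?thesis
      unfolding split by (intro cd_polynomials_add cd_polynomials_mult_left)
  qed
qed

lemma even_runs_replicate: "even_runs (replicate m True) \<longleftrightarrow> even m"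
  by (induction m rule: induct_nat_012) simp_all

lemma even_runs_replicate_append:
  "even_runs (replicate m True @ False # z) \<longleftrightarrow> even m \<and> even_runs z"
  by (induction m rule: induct_nat_012) simp_all

lemma bool_list_run_cases:
  "(\<exists>m. z = replicate m True) \<or> (\<exists>m z'. z = replicate m True @ False # z')"
proof (induction z)
  case (Cons s z)
  show ?case
  proof (cases s)
    case True
    from Cons.IH show ?thesis
    proof (elim disjE exE)
      fix m assume "z = replicate m True"
      then have "s # z = replicate (Suc m) True"
        using True by simp
      then show ?thesis by blast
    next
      fix m z' assume "z = replicate m True @ False # z'"
      then have "s # z = replicate (Suc m) True @ False # z'"
        using True by simp
      then show ?thesis by blast
    qed
  next
    case False
    then have "s # z = replicate 0 True @ False # z"
      by simp
    then show ?thesis by blast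
  qed
qed simp


section \<open>Identities for a single path\<close>

fun desc_letters :: "('l \<times> 'l) set \<Rightarrow> ('e \<Rightarrow> 'l) \<Rightarrow> 'e list \<Rightarrow> ab list" where
  "desc_letters rel lab (e # e' # p) =
    (if (lab e, lab e') \<in> rel then A else B) # desc_letters rel lab (e' # p)"
| "desc_letters rel lab _ = []"

lemma length_desc_letters: "length (desc_letters rel lab p) = length p - 1"
  by (induction rel lab p rule: desc_letters.induct) simp_all

lemma descent_word_Cons_Cons:
  "descent_word rel lab (e # e' # p) =
    (if (lab e, lab e') \<in> rel then ncvar A else ncvar B) * descent_word rel lab (e' # p)"
  by (simp add: descent_word_def upt_rec[of 0] map_Suc_upt[symmetric] comp_def del: upt_Suc)

lemma descent_word_eq:
  "descent_word rel lab p = Poly_Mapping.single (Word (desc_letters rel lab p)) 1"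
proof (induction rel lab p rule: desc_letters.induct)
  case (1 rel lab e e' p)
  then show ?case
    by (simp add: descent_word_Cons_Cons ncvar_def mult_single plus_free_word_def)
qed (simp_all add: descent_word_def flip: zero_free_word_def)

lemma rising_simps [simp]:
  "rising rel lab []"
  "rising rel lab [e]"
  "rising rel lab (e # e' # p) \<longleftrightarrow> (lab e, lab e') \<in> rel \<and> rising rel lab (e' # p)"
  by (auto simp: rising_def nth_Cons split: nat.splits)

text \<open>Lets every identity for rising paths be reused for falling ones by complementing the
  relation.\<close>

lemma falling_eq_rising: "falling rel lab = rising (- rel) lab"
  by (simp add: fun_eq_iff falling_def rising_def)

lemma rising_iff_desc_letters:
  "rising rel lab p \<longleftrightarrow> desc_letters rel lab p = replicate (length p - 1) A"
  by (induction rel lab p rule: desc_letters.induct) simp_all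

lemma falling_iff_desc_letters:
  "falling rel lab p \<longleftrightarrow> desc_letters rel lab p = replicate (length p - 1) B"
  unfolding falling_eq_rising
  by (induction rel lab p rule: desc_letters.induct) simp_all

text \<open>An initial ascent kills the cut at 0, and the rest is the negated sum for the tail. An
  initial descent leaves only the cuts at 0 and 1, which cancel.\<close>

lemma alternating_rising_falling_sum:
  fixes rel :: "('l \<times> 'l) set"
  assumes "p \<noteq> []"
  shows "(\<Sum>i\<le>length p. (- 1) ^ i *
    (of_bool (rising rel lab (take i p)) * of_bool (rising (- rel) lab (drop i p)))) = (0::int)"
  using assms
proof (induction p rule: induct_list012)
  case (3 e e' p)
  show ?case
  proof (cases "(lab e, lab e') \<in> rel")
    case True
    have "(\<Sum>i\<le>length (e' # p). (- 1) ^ i * (of_bool (rising rel lab (take i (e' # p))) *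
        of_bool (rising (- rel) lab (drop i (e' # p))))) = (0::int)"
      using 3 by simp
    then show ?thesis
      using True
      by (simp add: sum.atMost_Suc_shift sum_negf del: sum.atMost_Suc)
  next
    case False
    then show ?thesis
      by (simp add: sum.atMost_Suc_shift del: sum.atMost_Suc)
  qed
qed simp_all

text \<open>
  The value \<open>-1\<close> on the empty path turns the expansion of \<open>(a - b)\<^sup>n = (2a - c)\<^sup>n\<close> along the
  first occurrence of \<open>c\<close> into a recursion without boundary term.
\<close>

fun path_sign :: "('l \<times> 'l) set \<Rightarrow> ('e \<Rightarrow> 'l) \<Rightarrow> 'e list \<Rightarrow> int" where
  "path_sign rel lab [] = - 1"
| "path_sign rel lab [e] = 1"
| "path_sign rel lab (e # e' # p) =
    (if (lab e, lab e') \<in> rel then 1 else - 1) * path_sign rel lab (e' # p)"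

lemma path_sign_Compl:
  assumes "p \<noteq> []"
  shows "path_sign (- rel) lab p = (- 1) ^ (length p - 1) * path_sign rel lab p"
  using assms by (induction rel lab p rule: path_sign.induct) simp_all

text \<open>With s the sign of the tail, an initial ascent gives s - 2s = -s by induction; after an
  initial descent only the term s at \<open>i = 0\<close> survives.\<close>

lemma path_sign_expansion:
  assumes "p \<noteq> []"
  shows "(\<Sum>i<length p. 2 ^ i * (of_bool (rising rel lab (take (Suc i) p)) *
    path_sign rel lab (drop (Suc i) p))) = - path_sign rel lab p"
  using assms
proof (induction p rule: induct_list012)
  case (3 e e' p)
  have IH: "(\<Sum>i<length (e' # p). 2 ^ i * (of_bool (rising rel lab (take (Suc i) (e' # p))) *
        path_sign rel lab (drop (Suc i) (e' # p)))) = - path_sign rel lab (e' # p)"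
    using 3 by simp
  show ?case
  proof (cases "(lab e, lab e') \<in> rel")
    case True
    have "(\<Sum>i<length (e # e' # p). 2 ^ i * (of_bool (rising rel lab (take (Suc i) (e # e' # p))) *
        path_sign rel lab (drop (Suc i) (e # e' # p)))) =
      path_sign rel lab (e' # p) +
      2 * (\<Sum>i<length (e' # p). 2 ^ i * (of_bool (rising rel lab (take (Suc i) (e' # p))) *
        path_sign rel lab (drop (Suc i) (e' # p))))"
      using True
      by (subst list.size(4), subst add_Suc_right, subst sum.lessThan_Suc_shift)
        (simp add: sum_distrib_left mult.assoc del: sum.lessThan_Suc)
    also have "\<dots> = - path_sign rel lab (e # e' # p)"
      using True by (subst IH) simp
    finally show ?thesis .
  next
    case False
    then show ?thesis
      by (simp add: sum.lessThan_Suc_shift del: sum.lessThan_Suc)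
  qed
qed simp_all

lemma ce_sign_replicate:
  assumes "length p = Suc m"
  shows "ce_sign (replicate m True) (desc_letters rel lab p) = path_sign rel lab p"
  using assms
proof (induction m arbitrary: p)
  case 0
  then show ?case by (auto simp: length_Suc_conv)
next
  case (Suc m)
  then show ?case by (auto simp: length_Suc_conv)
qed

text \<open>The \<open>m\<close> letters e cover the junctions among the first \<open>Suc m\<close>
  edges; the letter c falls on the cut and contributes 1.\<close>

lemma ce_sign_replicate_append:
  assumes "length p = Suc (Suc (m + length z))"
  shows "ce_sign (replicate m True @ False # z) (desc_letters rel lab p) =
    path_sign rel lab (take (Suc m) p) * ce_sign z (desc_letters rel lab (drop (Suc m) p))"
  using assms
proof (induction m arbitrary: p)
  case 0
  then show ?case by (auto simp: length_Suc_conv)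
next
  case (Suc m)
  then obtain e e' q where "p = e # e' # q"
    by (auto simp: length_Suc_conv)
  then show ?case using Suc by simp
qed


section \<open>Sums over paths\<close>

context labeled_acyclic_digraph
begin

definition path_sum :: "('e list \<Rightarrow> int) \<Rightarrow> nat \<Rightarrow> 'v \<Rightarrow> 'v \<Rightarrow> int" where
  "path_sum \<phi> k x y = (\<Sum>p | awalk x p y \<and> length p = k. \<phi> p)"

lemma finite_paths: "finite {p. awalk x p y \<and> P p}"
proof (cases "x \<in> verts G \<and> y \<in> verts G")
  case True
  then show ?thesis
    using locally_finite[of x y] by (auto intro: finite_subset[rotated])
next
  case False
  then have "{p. awalk x p y \<and> P p} = {}"
    by (auto dest: awalk_hd_in_verts awalk_last_in_verts)
  then show ?thesis by (simp only: finite.emptyI)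
qed

lemma path_sum_cong:
  assumes "k = k'" and "\<And>p. length p = k' \<Longrightarrow> \<phi> p = \<psi> p"
  shows "path_sum \<phi> k x y = path_sum \<psi> k' x y"
  unfolding path_sum_def using assms by (intro sum.cong) auto

lemma path_sum_linear:
  "path_sum (\<lambda>p. \<Sum>i\<in>I. c i * \<phi> i p) k x y = (\<Sum>i\<in>I. c i * path_sum (\<phi> i) k x y)"
  unfolding path_sum_def sum_distrib_left by (rule sum.swap)

text \<open>Index set for matrix products: \<open>verts G\<close> may be infinite, but only finitely
  many vertices lie on paths of a given length from \<open>x\<close> to \<open>y\<close>.\<close>

definition mid_verts :: "nat \<Rightarrow> nat \<Rightarrow> 'v \<Rightarrow> 'v \<Rightarrow> 'v set" where
  "mid_verts i j x y =
    {s. \<exists>p q. awalk x p s \<and> length p = i \<and> awalk s q y \<and> length q = j}"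

lemma mid_vertsI:
  "awalk x p s \<Longrightarrow> length p = i \<Longrightarrow> awalk s q y \<Longrightarrow> length q = j \<Longrightarrow> s \<in> mid_verts i j x y"
  by (auto simp: mid_verts_def)

text \<open>Cutting after \<open>i\<close> edges is a bijection onto pairs of paths that meet at a
  vertex, so concatenation becomes matrix multiplication.\<close>

lemma path_sum_split:
  "path_sum (\<lambda>p. \<phi> (take i p) * \<psi> (drop i p)) (i + j) x y =
    (\<Sum>s\<in>mid_verts i j x y. path_sum \<phi> i x s * path_sum \<psi> j s y)"
proof -
  let ?W = "\<lambda>x y k. {p. awalk x p y \<and> length p = k}"
  have fin: "finite (mid_verts i j x y)"
  proof (rule finite_surj)
    show "finite (?W x y (i + j))"
      by (rule finite_paths)
    show "mid_verts i j x y \<subseteq> (\<lambda>p. awlast x (take i p)) ` ?W x y (i + j)"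
    proof
      fix s assume "s \<in> mid_verts i j x y"
      then obtain p q where "awalk x p s" "length p = i" "awalk s q y" "length q = j"
        by (auto simp: mid_verts_def)
      then show "s \<in> (\<lambda>p. awlast x (take i p)) ` ?W x y (i + j)"
        by (intro image_eqI[of _ _ "p @ q"]) (auto simp: awalk_appendI)
    qed
  qed
  have split: "awalk x (take n p) (awlast x (take n p)) \<and> awalk (awlast x (take n p)) (drop n p) y"
    if "awalk x p y" for n p
    using that awalk_append_iff[of x "take n p" "drop n p" y] by simp
  have mid: "awlast x (take i p) \<in> mid_verts i j x y" if "awalk x p y" "length p = i + j" for p
    using that split[of p i] by (intro mid_vertsI[of _ "take i p" _ _ "drop i p"]) auto
  have "(\<Sum>s\<in>mid_verts i j x y. path_sum \<phi> i x s * path_sum \<psi> j s y) =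
    (\<Sum>s\<in>mid_verts i j x y. \<Sum>(p, q)\<in>?W x s i \<times> ?W s y j. \<phi> p * \<psi> q)"
    by (simp add: path_sum_def sum_product sum.cartesian_product)
  also have "\<dots> = (\<Sum>(s, p, q)\<in>Sigma (mid_verts i j x y) (\<lambda>s. ?W x s i \<times> ?W s y j). \<phi> p * \<psi> q)"
    using fin by (subst sum.Sigma) (auto simp: finite_paths)
  also have "\<dots> = (\<Sum>p\<in>?W x y (i + j). \<phi> (take i p) * \<psi> (drop i p))"
    by (rule sum.reindex_bij_witness[where
          i = "\<lambda>p. (awlast x (take i p), take i p, drop i p)" and j = "\<lambda>(s, p, q). p @ q"])
      (use split in \<open>auto intro: awalk_appendI mid\<close>)
  finally show ?thesis
    by (simp add: path_sum_def)
qed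

section \<open>Rising and falling path counts\<close>

abbreviation rising_sum :: "('l \<times> 'l) set \<Rightarrow> nat \<Rightarrow> 'v \<Rightarrow> 'v \<Rightarrow> int" where
  "rising_sum R \<equiv> path_sum (\<lambda>p. of_bool (rising R lab p))"

lemma num_rising_eq: "int (num_rising G R lab x y k) = rising_sum R k x y"
  unfolding num_rising_def path_sum_def dipaths_def
  by (subst sum_of_bool_eq) (auto simp: finite_paths intro: arg_cong[where f = card])

text \<open>The coefficient of t^k in the matrix identity R(-t) F(t) = I, obtained by summing the
  identity for single paths.\<close>

lemma alternating_rising_sum:
  assumes "k > 0"
  shows "(\<Sum>i\<le>k. (- 1) ^ i * (\<Sum>s\<in>mid_verts i (k - i) x y.
    rising_sum R i x s * rising_sum (- R) (k - i) s y)) = 0"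
proof -
  have "(\<Sum>i\<le>k. (- 1) ^ i * (\<Sum>s\<in>mid_verts i (k - i) x y.
      rising_sum R i x s * rising_sum (- R) (k - i) s y)) =
    (\<Sum>i\<le>k. (- 1) ^ i * path_sum (\<lambda>p. of_bool (rising R lab (take i p)) *
      of_bool (rising (- R) lab (drop i p))) k x y)"
    by (intro sum.cong refl) (simp flip: path_sum_split)
  also have "\<dots> = path_sum (\<lambda>p. \<Sum>i\<le>k. (- 1) ^ i * (of_bool (rising R lab (take i p)) *
      of_bool (rising (- R) lab (drop i p)))) k x y"
    by (simp add: path_sum_linear)
  also have "\<dots> = path_sum (\<lambda>p. 0) k x y"
    using assms alternating_rising_falling_sum[of _ R lab] by (intro path_sum_cong) auto
  finally show ?thesis
    by (simp add: path_sum_def)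
qed

lemma rising_sum_0: "rising_sum R 0 x y = of_bool (x \<in> verts G \<and> x = y)"
proof -
  have "{p. awalk x p y \<and> length p = 0} = (if x \<in> verts G \<and> x = y then {[]} else {})"
    by (auto simp: awalk_Nil_iff)
  then have "rising_sum R 0 x y =
      (\<Sum>p\<in>(if x \<in> verts G \<and> x = y then {[]} else {}). of_bool (rising R lab p))"
    by (simp only: path_sum_def)
  then show ?thesis
    by (cases "x \<in> verts G \<and> x = y") auto
qed

text \<open>
  For odd \<open>k\<close>, the relation \<open>\<Sum>\<^sub>i (-1)\<^sup>i R\<^sub>i F\<^sub>k\<^sub>-\<^sub>i = 0\<close> and the one with \<open>R\<close> and \<open>F\<close> exchanged have,
  by induction, the same inner terms, while the two outer terms change sign.
\<close>

lemma rising_sum_eq_of_even: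
  assumes even: "\<And>x y k. even k \<Longrightarrow> k > 0 \<Longrightarrow> rising_sum R k x y = rising_sum (- R) k x y"
  shows "rising_sum R k x y = rising_sum (- R) k x y"
proof (induction k arbitrary: x y rule: less_induct)
  case (less k)
  consider "k = 0" | "even k" "k > 0" | "odd k"
    by auto
  then show ?case
  proof cases
    case 1
    then show ?thesis by (simp add: rising_sum_0)
  next
    case 2
    then show ?thesis by (rule even)
  next
    case 3
    then obtain m where k: "k = Suc m" "even m"
      by (cases k) auto
    define T where "T = (\<lambda>R i. (- 1) ^ i * (\<Sum>s\<in>mid_verts i (k - i) x y.
      rising_sum R i x s * rising_sum (- R) (k - i) s y))"
    have full: "(\<Sum>i\<le>k. T S i) = T S 0 + (\<Sum>i<m. T S (Suc i)) + T S k" for S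
      by (simp add: k(1) sum.atMost_shift)
    have inner: "T R (Suc i) = T (- R) (Suc i)" if "i < m" for i
      unfolding T_def using that less.IH by (simp add: k)
    have first: "T S 0 = rising_sum (- S) k x y" for S
      by (simp add: T_def flip: path_sum_split)
    have last: "T S k = - rising_sum S k x y" for S
      unfolding T_def path_sum_split[symmetric] using 3 by (simp cong: path_sum_cong)
    have "(\<Sum>i\<le>k. T R i) = 0" "(\<Sum>i\<le>k. T (- R) i) = 0"
      using alternating_rising_sum[of k] k(1) by (simp_all only: T_def)
    moreover have "(\<Sum>i<m. T R (Suc i)) = (\<Sum>i<m. T (- R) (Suc i))"
      using inner by (intro sum.cong) auto
    ultimately show ?thesis
      using full[of R] full[of "- R"] first[of R] first[of "- R"] last[of R] last[of "- R"]
      by simp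
  qed
qed

section \<open>Signed path sums\<close>

lemma sign_sum_expansion:
  assumes "k > 0"
  shows "path_sum (path_sign R lab) k x y =
    - (\<Sum>i<k. 2 ^ i * (\<Sum>s\<in>mid_verts (Suc i) (k - Suc i) x y.
      rising_sum R (Suc i) x s * path_sum (path_sign R lab) (k - Suc i) s y))"
proof -
  have "(\<Sum>i<k. 2 ^ i * (\<Sum>s\<in>mid_verts (Suc i) (k - Suc i) x y.
      rising_sum R (Suc i) x s * path_sum (path_sign R lab) (k - Suc i) s y)) =
    (\<Sum>i<k. 2 ^ i * path_sum (\<lambda>p. of_bool (rising R lab (take (Suc i) p)) *
      path_sign R lab (drop (Suc i) p)) k x y)"
    by (intro sum.cong refl) (simp flip: path_sum_split)
  also have "\<dots> = path_sum (\<lambda>p. \<Sum>i<k. 2 ^ i * (of_bool (rising R lab (take (Suc i) p)) *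
      path_sign R lab (drop (Suc i) p))) k x y"
    by (simp add: path_sum_linear)
  also have "\<dots> = path_sum (\<lambda>p. - path_sign R lab p) k x y"
    using assms path_sign_expansion[of _ R lab] by (intro path_sum_cong) auto
  finally show ?thesis
    by (simp add: path_sum_def sum_negf)
qed

text \<open>Both sides satisfy the recursion \<open>sign_sum_expansion\<close> with the same
  coefficients and agree on the empty path.\<close>

lemma sign_sum_Compl:
  assumes "\<And>x y k. rising_sum R k x y = rising_sum (- R) k x y"
  shows "path_sum (path_sign (- R) lab) k x y = path_sum (path_sign R lab) k x y"
proof (induction k arbitrary: x y rule: less_induct)
  case (less k)
  show ?case
  proof (cases "k = 0")
    case True
    then show ?thesis
      by (intro path_sum_cong) simp_all
  next
    case False
    have "path_sum (path_sign (- R) lab) k x y =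
      - (\<Sum>i<k. 2 ^ i * (\<Sum>s\<in>mid_verts (Suc i) (k - Suc i) x y.
        rising_sum R (Suc i) x s * path_sum (path_sign R lab) (k - Suc i) s y))"
      using False less.IH by (subst sign_sum_expansion) (simp_all add: assms[symmetric])
    then show ?thesis
      using sign_sum_expansion[of k R x y] False by simp
  qed
qed

text \<open>Complementing the relation flips \<open>k - 1\<close> signs, an odd number, so the sum
  equals its own negative.\<close>

lemma sign_sum_even:
  assumes "\<And>x y k. rising_sum R k x y = rising_sum (- R) k x y" and "even k" "k > 0"
  shows "path_sum (path_sign R lab) k x y = 0"
proof -
  have "path_sum (path_sign (- R) lab) k x y = path_sum (\<lambda>p. - path_sign R lab p) k x y"
  proof (rule path_sum_cong[OF refl])
    fix p :: "'e list" assume p: "length p = k"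
    then show "path_sign (- R) lab p = - path_sign R lab p"
      using assms(2,3) path_sign_Compl[of p R lab] by auto
  qed
  then show ?thesis
    using sign_sum_Compl[OF assms(1), of k x y] by (simp add: path_sum_def sum_negf)
qed

text \<open>Cut at the first c. If the leading run has odd length \<open>m\<close>, its paths have
  even length \<open>Suc m\<close> and their signed sum vanishes; otherwise the odd run lies in the
  remainder and induction applies.\<close>

lemma ce_sum_eq_0:
  assumes "\<And>x y k. rising_sum R k x y = rising_sum (- R) k x y" and "\<not> even_runs z"
  shows "path_sum (\<lambda>p. ce_sign z (desc_letters R lab p)) (Suc (length z)) x y = 0"
  using assms(2)
proof (induction "length z" arbitrary: z x y rule: less_induct)
  case less
  consider m where "z = replicate m True" | m z' where "z = replicate m True @ False # z'"
    using bool_list_run_cases by blast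
  then show ?case
  proof cases
    case 1
    then have "odd m"
      using less.prems by (simp add: even_runs_replicate)
    then have "path_sum (path_sign R lab) (Suc m) x y = 0"
      by (intro sign_sum_even assms(1)) simp_all
    moreover have "path_sum (\<lambda>p. ce_sign z (desc_letters R lab p)) (Suc (length z)) x y =
        path_sum (path_sign R lab) (Suc m) x y"
      by (simp add: 1 ce_sign_replicate cong: path_sum_cong)
    ultimately show ?thesis by simp
  next
    case 2
    have "path_sum (\<lambda>p. ce_sign z (desc_letters R lab p)) (Suc (length z)) x y =
      path_sum (\<lambda>p. path_sign R lab (take (Suc m) p) *
        ce_sign z' (desc_letters R lab (drop (Suc m) p))) (Suc m + Suc (length z')) x y"
      by (simp add: 2 ce_sign_replicate_append cong: path_sum_cong)
    also have "\<dots> = (\<Sum>s\<in>mid_verts (Suc m) (Suc (length z')) x y.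
        path_sum (path_sign R lab) (Suc m) x s *
        path_sum (\<lambda>p. ce_sign z' (desc_letters R lab p)) (Suc (length z')) s y)"
      by (rule path_sum_split)
    also have "\<dots> = 0"
    proof (cases "even m")
      case True
      then have "\<not> even_runs z'"
        using less.prems by (simp add: 2 even_runs_replicate_append)
      then show ?thesis
        using less.hyps[of z'] by (simp add: 2)
    next
      case False
      then show ?thesis
        using sign_sum_even[OF assms(1), of "Suc m"] by simp
    qed
    finally show ?thesis .
  qed
qed

section \<open>From path sums to the ab-index\<close>

lemma ab_index_eq_hom_poly_sum:
  assumes "x \<noteq> y"
  shows "ab_index G R lab x y = (\<Sum>k\<in>length ` dipaths G x y. hom_poly (k - 1)
    (\<lambda>w. path_sum (\<lambda>p. of_bool (desc_letters R lab p = w)) k x y))"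
proof -
  have fin: "finite (dipaths G x y)"
    using finite_paths[of x y "\<lambda>_. True"] by (simp add: dipaths_def)
  have "ab_index G R lab x y = (\<Sum>k\<in>length ` dipaths G x y.
      \<Sum>p | p \<in> dipaths G x y \<and> length p = k. descent_word R lab p)"
    unfolding ab_index_def using fin by (rule sum.image_gen)
  also have "\<dots> = (\<Sum>k\<in>length ` dipaths G x y. hom_poly (k - 1)
      (\<lambda>w. path_sum (\<lambda>p. of_bool (desc_letters R lab p = w)) k x y))"
    unfolding path_sum_def hom_poly_sum
    by (intro sum.cong)
      (auto simp: dipaths_def descent_word_eq length_desc_letters simp flip: hom_poly_indicator)
  finally show ?thesis .
qed

lemma ab_index_cd:
  assumes "\<And>x y k. rising_sum R k x y = rising_sum (- R) k x y" and "x \<noteq> y"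
  shows "ab_index G R lab x y \<in> cd_polynomials"
  unfolding ab_index_eq_hom_poly_sum[OF assms(2)]
proof (intro cd_polynomials_sum hom_poly_cd)
  fix k z
  assume "k \<in> length ` dipaths G x y" and z: "length z = k - 1" "\<not> even_runs z"
  \<comment> \<open>Since \<open>x\<close> and \<open>y\<close> differ, no path is empty and the
    truncated \<open>k - 1\<close> is harmless.\<close>
  then have k: "k = Suc (length z)"
    using assms(2) by (cases k) (auto simp: dipaths_def awalk_Nil_iff)
  have "ce_pair (\<lambda>w. path_sum (\<lambda>p. of_bool (desc_letters R lab p = w)) k x y) z =
    path_sum (\<lambda>p. ce_sign z (desc_letters R lab p)) k x y"
    unfolding path_sum_def ce_pair_sum
    by (intro sum.cong) (auto simp: k length_desc_letters intro: ce_pair_indicator)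
  then show "ce_pair (\<lambda>w. path_sum (\<lambda>p. of_bool (desc_letters R lab p = w)) k x y) z = 0"
    using ce_sum_eq_0[OF assms(1) z(2)] k by simp
qed

lemma lookup_ab_index:
  assumes "x \<noteq> y"
  shows "Poly_Mapping.lookup (ab_index G R lab x y) (Word w) =
    path_sum (\<lambda>p. of_bool (desc_letters R lab p = w)) (Suc (length w)) x y"
proof -
  have ne: "p \<noteq> []" if "awalk x p y" for p
    using that assms by (auto simp: awalk_Nil_iff)
  have "Poly_Mapping.lookup (ab_index G R lab x y) (Word w) =
    (\<Sum>p | awalk x p y. of_bool (desc_letters R lab p = w))"
    by (simp add: ab_index_def dipaths_def descent_word_eq lookup_sum lookup_single when_def
      of_bool_def eq_commute[of w])
  also have "\<dots> = path_sum (\<lambda>p. of_bool (desc_letters R lab p = w)) (Suc (length w)) x y"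
    unfolding path_sum_def using finite_paths[of x y "\<lambda>_. True"]
    by (intro sum.mono_neutral_right) (auto simp: length_desc_letters dest: ne)
  finally show ?thesis .
qed

text \<open>The coefficients of a^n and b^n in the index count the rising and falling paths of
  length n + 1; the symmetry of cd-polynomials equates them.\<close>

lemma rising_sum_eq_of_cd:
  assumes "x \<noteq> y" and "ab_index G R lab x y \<in> cd_polynomials"
  shows "rising_sum R k x y = rising_sum (- R) k x y"
proof (cases k)
  case 0
  then show ?thesis by (simp add: rising_sum_0)
next
  case (Suc n)
  have "rising_sum R k x y = Poly_Mapping.lookup (ab_index G R lab x y) (Word (replicate n A))"
    by (simp add: Suc assms(1) lookup_ab_index rising_iff_desc_letters cong: path_sum_cong)
  also have "\<dots> = Poly_Mapping.lookup (ab_index G R lab x y) (Word (replicate n B))"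
    using cd_polynomials_lookup_flip[OF assms(2), of "replicate n A"] by simp
  also have "\<dots> = rising_sum (- R) k x y"
    by (simp add: Suc assms(1) lookup_ab_index falling_iff_desc_letters flip: falling_eq_rising
      cong: path_sum_cong)
  finally show ?thesis .
qed

lemma closed_path_Nil:
  assumes "awalk x p x"
  shows "p = []"
proof (rule ccontr)
  assume "p \<noteq> []"
  with assms have "closed_w p"
    by (auto simp: closed_w_def)
  then show False
    using closed_w_imp_cycle no_cycle by metis
qed

text \<open>Covers the trivial intervals, about which statement (iii) says nothing: by acyclicity
  only the empty path is closed.\<close>

lemma rising_sum_closed: "rising_sum R k x x = rising_sum (- R) k x x"
  unfolding path_sum_def
proof (rule sum.cong[OF refl])
  fix p assume "p \<in> {p. awalk x p x \<and> length p = k}"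
  then have "p = []"
    using closed_path_Nil by blast
  then show "of_bool (rising R lab p) = (of_bool (rising (- R) lab p) :: int)"
    by simp
qed

end

theorem theorem4p7:
  fixes G :: "('v, 'e) pre_digraph"
    and \<Lambda> :: "'l set" and rel :: "('l \<times> 'l) set" and lab :: "'e \<Rightarrow> 'l"
  assumes "labeled_acyclic_digraph G \<Lambda> rel lab"
  defines "stmt_i \<equiv> \<forall>x\<in>verts G. \<forall>y\<in>verts G. path_le G x y \<longrightarrow>
      (\<forall>k. num_rising G rel lab x y k = num_falling G rel lab x y k)"
    and "stmt_ii \<equiv> \<forall>x\<in>verts G. \<forall>y\<in>verts G. path_le G x y \<longrightarrow>
      (\<forall>k. even k \<and> k > 0 \<longrightarrow> num_rising G rel lab x y k = num_falling G rel lab x y k)"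
    and "stmt_iii \<equiv> \<forall>x\<in>verts G. \<forall>y\<in>verts G. path_less G x y \<longrightarrow>
      ab_index G rel lab x y \<in> cd_polynomials"
  shows "(stmt_i \<longleftrightarrow> stmt_ii) \<and> (stmt_ii \<longleftrightarrow> stmt_iii)"
proof -
  interpret labeled_acyclic_digraph G \<Lambda> rel lab
    by (rule assms(1))
  have num_eq_iff: "num_rising G rel lab x y k = num_falling G rel lab x y k \<longleftrightarrow>
      rising_sum rel k x y = rising_sum (- rel) k x y" for x y k
  proof -
    have "num_falling G rel lab x y k = num_rising G (- rel) lab x y k"
      by (simp add: num_falling_def num_rising_def falling_eq_rising)
    then show ?thesis
      by (simp flip: num_rising_eq)
  qed
  \<comment> \<open>Extends the hypothesis from intervals to all pairs \<open>x\<close>,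
    \<open>y\<close>, as the inductions over path sums require.\<close>
  have no_path: "rising_sum rel k x y = rising_sum (- rel) k x y"
    if "\<not> (x \<in> verts G \<and> y \<in> verts G \<and> path_le G x y)" for x y k
  proof -
    have "{p. awalk x p y \<and> length p = k} = {}"
      using that by (auto simp: path_le_def dipaths_def dest: awalk_hd_in_verts awalk_last_in_verts)
    then show ?thesis
      unfolding path_sum_def by (simp only: sum.empty)
  qed
  have "stmt_ii" if stmt_i
    using that by (simp add: stmt_i_def stmt_ii_def)
  moreover have "stmt_iii" if stmt_ii
  proof -
    have "rising_sum rel k x y = rising_sum (- rel) k x y" if "even k" "k > 0" for x y k
      using \<open>stmt_ii\<close> that no_path[where x = x and y = y] by (auto simp: stmt_ii_def num_eq_iff)
    then have "rising_sum rel k x y = rising_sum (- rel) k x y" for x y k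
      by (rule rising_sum_eq_of_even)
    then show ?thesis
      by (simp add: stmt_iii_def path_less_def ab_index_cd)
  qed
  moreover have "stmt_i" if stmt_iii
    using that rising_sum_eq_of_cd[where R = rel] rising_sum_closed[of rel]
    unfolding stmt_i_def stmt_iii_def num_eq_iff path_less_def by metis
  ultimately show ?thesis
    by metis
qed

end
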